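(* Assume that there are constants $0<l\le L$ with $l\le K(u)\le L$ for $0\le u\le1$ and $K(u)=0$ for $u>1$; that $h_n>0$, $h_n\to0$ and $n\phi(\mathbf{x},h_n)\to\infty$ as $n\to\infty$; and that for some $\nu>2$ the quantity $\mathbb{E}\big[\|G(\mathbf{Y})-\mathbb{E}[G(\mathbf{Y})\mid\mathbf{X}=\mathbf{z}]\|^\nu\mid\mathbf{X}=\mathbf{z}\big]$ is uniformly bounded for $\mathbf{z}$ in a neighborhood of $\mathbf{x}$. Let $$V_n(\mathbf{x})=\mathbb{L}_{\mathbf{x}}\left(\frac{\sum_{i=1}^{n}\big[G(\mathbf{Y}_i)-\mathbb{E}[G(\mathbf{Y}_i)\mid\mathbf{X}_i]\big]K(h_n^{-1}d(\mathbf{x},\mathbf{X}_i))}{\sum_{i=1}^{n}K(h_n^{-1}d(\mathbf{x},\mathbf{X}_i))}\right).$$ Then $n\,\phi(\mathbf{x},h_n)\,\mathbb{E}\big[\|V_n(\mathbf{x})\|^2\big]=O(1)$ as $n\to\infty$.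
   Context: $(\mathcal{C},d)$ is a complete separable metric space, $\mathcal{R}$ is a measurable space, $(\mathbf{X},\mathbf{Y})$ is a random element of $\mathcal{C}\times\mathcal{R}$, and $(\mathbf{X}_i,\mathbf{Y}_i)$, $i\ge1$, are i.i.d. copies. A regular conditional distribution of $\mathbf{Y}$ given $\mathbf{X}=\mathbf{z}$ is fixed and $\mathbb{E}[\,\cdot\mid\mathbf{X}=\mathbf{z}]$ is taken with respect to it; Banach-space-valued expectations are in the Bochner sense. $\mathbf{x}\in\mathcal{C}$ is fixed, $\phi(\mathbf{x},h)=\mathbb{P}[d(\mathbf{x},\mathbf{X})\le h]$, $K:[0,\infty)\to[0,\infty)$ is a measurable kernel, $\{h_n\}$ is a deterministic bandwidth sequence. $\mathcal{B}$ is a separable Banach space of type 2 with a Schauder basis, $\mathcal{G}$ is a separable Banach space, $G:\mathcal{R}\to\mathcal{G}$ is measurable and $\mathbb{L}_{\mathbf{x}}:\mathcal{G}\to\mathcal{B}$ is a continuous linear map. Type 2 means: there is $c>0$ such that for all $n\ge1$ and all independent zero-mean random elements $\mathbf{Z}_1,\dots,\mathbf{Z}_n$ with $\mathbb{E}\|\mathbf{Z}_i\|^2<\infty$, $\mathbb{E}\|\mathbf{Z}_1+\dots+\mathbf{Z}_n\|^2\le c\sum_{i}\mathbb{E}\|\mathbf{Z}_i\|^2$. Quotients with zero denominator are read as $0$. *)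

theory Defs
  imports "HOL-Probability.Probability" "HOL-Library.Landau_Symbols"
begin

definition regular_cond_distr ::
  "'w measure \<Rightarrow> 'c measure \<Rightarrow> 'r measure \<Rightarrow> ('w \<Rightarrow> 'c) \<Rightarrow> ('w \<Rightarrow> 'r) \<Rightarrow> ('c \<Rightarrow> 'r measure) \<Rightarrow> bool"
where
  "regular_cond_distr M S R X Y \<kappa> \<longleftrightarrow>
     \<kappa> \<in> S \<rightarrow>\<^sub>M prob_algebra R \<and>
     (\<forall>A\<in>sets S. \<forall>B\<in>sets R.
        emeasure M {\<omega> \<in> space M. X \<omega> \<in> A \<and> Y \<omega> \<in> B} =
        (\<integral>\<^sup>+ z\<in>A. emeasure (\<kappa> z) B \<partial>distr M S X))"

text \<open>
  Conditional expectation of \<open>G(Y)\<close> given \<open>X = z\<close>, as a Bochner integral against the fixed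
  version \<open>\<kappa>\<close> of the conditional distribution. Where \<open>G\<close> is not \<open>\<kappa> z\<close>-integrable the library
  integral is \<open>0\<close>.
\<close>

definition cond_mean ::
  "('c \<Rightarrow> 'r measure) \<Rightarrow> ('r \<Rightarrow> 'g::{banach, second_countable_topology}) \<Rightarrow> 'c \<Rightarrow> 'g"
where
  "cond_mean \<kappa> G z = (\<integral>y. G y \<partial>\<kappa> z)"

definition small_ball_prob :: "'w measure \<Rightarrow> ('w \<Rightarrow> 'c::metric_space) \<Rightarrow> 'c \<Rightarrow> real \<Rightarrow> real" where
  "small_ball_prob M X x h = measure M {\<omega> \<in> space M. dist x (X \<omega>) \<le> h}"

text \<open>
  The probability spaces range over the single sample type \<open>nat \<Rightarrow> 'b\<close>. This is no restriction:
  only the joint law of \<open>Z 1, \<dots>, Z n\<close> matters. Lemma \<open>type_2_any_space\<close> below gives the inequality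
  on every sample type.
\<close>

definition type_2 :: "'b::{banach, second_countable_topology} itself \<Rightarrow> bool" where
  "type_2 _ \<longleftrightarrow>
     (\<exists>c>0. \<forall>(P :: (nat \<Rightarrow> 'b) measure) (Z :: nat \<Rightarrow> (nat \<Rightarrow> 'b) \<Rightarrow> 'b) n.
        n \<ge> 1 \<longrightarrow> prob_space P \<longrightarrow>
        prob_space.indep_vars P (\<lambda>_. borel) Z {1..n} \<longrightarrow>
        (\<forall>i\<in>{1..n}. integrable P (\<lambda>\<omega>. (norm (Z i \<omega>))\<^sup>2) \<and> (\<integral>\<omega>. Z i \<omega> \<partial>P) = 0) \<longrightarrow>
        (\<integral>\<omega>. (norm (\<Sum>i=1..n. Z i \<omega>))\<^sup>2 \<partial>P) \<le> c * (\<Sum>i=1..n. \<integral>\<omega>. (norm (Z i \<omega>))\<^sup>2 \<partial>P))"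

text \<open>
  The index set is all of \<open>nat\<close> or an initial segment, so that finite-dimensional spaces have
  Schauder bases too (namely their ordinary bases).
\<close>

definition has_schauder_basis :: "'b::banach itself \<Rightarrow> bool" where
  "has_schauder_basis _ \<longleftrightarrow>
     (\<exists>(e :: nat \<Rightarrow> 'b) I. (I = UNIV \<or> (\<exists>m. I = {..<m})) \<and>
        (\<forall>v. \<exists>!a :: nat \<Rightarrow> real. (\<forall>k. k \<notin> I \<longrightarrow> a k = 0) \<and> (\<lambda>k. a k *\<^sub>R e k) sums v))"

text \<open>\<open>inverse 0 = 0\<close>, so \<open>V_stat\<close> obeys the convention that quotients with zero denominator are \<open>0\<close>.\<close>

definition V_stat ::
  "('g::{banach, second_countable_topology} \<Rightarrow> 'b) \<Rightarrow> ('r \<Rightarrow> 'g) \<Rightarrow> ('c::metric_space \<Rightarrow> 'r measure) \<Rightarrow>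
   (real \<Rightarrow> real) \<Rightarrow> (nat \<Rightarrow> real) \<Rightarrow> 'c \<Rightarrow> (nat \<Rightarrow> 'w \<Rightarrow> 'c) \<Rightarrow> (nat \<Rightarrow> 'w \<Rightarrow> 'r) \<Rightarrow> nat \<Rightarrow> 'w \<Rightarrow> 'b"
where
  "V_stat L G \<kappa> K h x Xs Ys n \<omega> =
     L ((\<Sum>i=1..n. K (dist x (Xs i \<omega>) / h n) *\<^sub>R (G (Ys i \<omega>) - cond_mean \<kappa> G (Xs i \<omega>)))
        /\<^sub>R (\<Sum>i=1..n. K (dist x (Xs i \<omega>) / h n)))"

lemma type_2_any_space:
  assumes "type_2 TYPE('b::{banach, second_countable_topology})"
  shows "\<exists>c>0. \<forall>(M :: 'w measure) (Z :: nat \<Rightarrow> 'w \<Rightarrow> 'b) n.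
        n \<ge> 1 \<longrightarrow> prob_space M \<longrightarrow>
        prob_space.indep_vars M (\<lambda>_. borel) Z {1..n} \<longrightarrow>
        (\<forall>i\<in>{1..n}. integrable M (\<lambda>\<omega>. (norm (Z i \<omega>))\<^sup>2) \<and> (\<integral>\<omega>. Z i \<omega> \<partial>M) = 0) \<longrightarrow>
        (\<integral>\<omega>. (norm (\<Sum>i=1..n. Z i \<omega>))\<^sup>2 \<partial>M) \<le> c * (\<Sum>i=1..n. \<integral>\<omega>. (norm (Z i \<omega>))\<^sup>2 \<partial>M)"
proof -
  obtain c :: real where c: "c > 0" and ineq:
    "\<forall>(P :: (nat \<Rightarrow> 'b) measure) (Z :: nat \<Rightarrow> (nat \<Rightarrow> 'b) \<Rightarrow> 'b) n.
        n \<ge> 1 \<longrightarrow> prob_space P \<longrightarrow>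
        prob_space.indep_vars P (\<lambda>_. borel) Z {1..n} \<longrightarrow>
        (\<forall>i\<in>{1..n}. integrable P (\<lambda>\<omega>. (norm (Z i \<omega>))\<^sup>2) \<and> (\<integral>\<omega>. Z i \<omega> \<partial>P) = 0) \<longrightarrow>
        (\<integral>\<omega>. (norm (\<Sum>i=1..n. Z i \<omega>))\<^sup>2 \<partial>P) \<le> c * (\<Sum>i=1..n. \<integral>\<omega>. (norm (Z i \<omega>))\<^sup>2 \<partial>P)"
    using assms unfolding type_2_def by (elim exE conjE)
  have "(\<integral>\<omega>. (norm (\<Sum>i=1..n. Z i \<omega>))\<^sup>2 \<partial>M) \<le> c * (\<Sum>i=1..n. \<integral>\<omega>. (norm (Z i \<omega>))\<^sup>2 \<partial>M)"
    if n: "n \<ge> 1" and M: "prob_space M" and indep: "prob_space.indep_vars M (\<lambda>_. borel) Z {1..n}"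
      and Z: "\<forall>i\<in>{1..n}. integrable M (\<lambda>\<omega>. (norm (Z i \<omega>))\<^sup>2) \<and> (\<integral>\<omega>. Z i \<omega> \<partial>M) = 0"
    for M :: "'w measure" and Z :: "nat \<Rightarrow> 'w \<Rightarrow> 'b" and n
  proof -
    interpret M: prob_space M by (rule M)
    have Zm: "Z i \<in> borel_measurable M" if "i \<in> {1..n}" for i
      using indep that unfolding M.indep_vars_def by auto
    define B where "B = (\<Pi>\<^sub>M i\<in>{1..n}. (borel :: 'b measure))"
    define T where "T = (\<lambda>\<omega>. \<lambda>i\<in>{1..n}. Z i \<omega>)"
    have T[measurable]: "T \<in> M \<rightarrow>\<^sub>M B"
      unfolding T_def B_def by (intro measurable_restrict Zm)
    define P where "P = distr M B T"
    interpret P: prob_space P unfolding P_def by (rule M.prob_space_distr) (rule T)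
    have cm[measurable]: "(\<lambda>\<omega>. \<omega> i) \<in> borel_measurable B" if "i \<in> {1..n}" for i
      unfolding B_def using that by (intro measurable_component_singleton)
    have setsP[measurable_cong]: "sets P = sets B" by (simp add: P_def)
    have Ti: "T \<omega> i = Z i \<omega>" if "i \<in> {1..n}" for i \<omega>
      using that by (simp add: T_def)
    have marg: "distr P borel (\<lambda>\<omega>. \<omega> i) = distr M borel (Z i)" if "i \<in> {1..n}" for i
      unfolding P_def using that
      by (subst distr_distr[OF cm T]) (simp_all add: comp_def Ti)
    have "distr P B (\<lambda>\<omega>. \<lambda>i\<in>{1..n}. \<omega> i) = distr M B T"
      unfolding P_def
    proof (subst distr_distr)
      show "(\<lambda>\<omega>. \<lambda>i\<in>{1..n}. \<omega> i) \<in> B \<rightarrow>\<^sub>M B"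
        unfolding B_def by (intro measurable_restrict measurable_component_singleton)
      show "T \<in> M \<rightarrow>\<^sub>M B" by (rule T)
      show "distr M B ((\<lambda>\<omega>. \<lambda>i\<in>{1..n}. \<omega> i) \<circ> T) = distr M B T"
        by (rule arg_cong[where f="distr M B"]) (auto simp: T_def fun_eq_iff)
    qed
    also have "\<dots> = (\<Pi>\<^sub>M i\<in>{1..n}. distr M borel (Z i))"
      unfolding B_def T_def
      by (rule M.indep_vars_iff_distr_eq_PiM'[THEN iffD1, OF _ _ indep]) (use n Zm in simp_all)
    also have "\<dots> = (\<Pi>\<^sub>M i\<in>{1..n}. distr P borel (\<lambda>\<omega>. \<omega> i))"
      by (intro PiM_cong refl) (simp only: marg)
    finally have indepP: "P.indep_vars (\<lambda>_. borel) (\<lambda>i \<omega>. \<omega> i) {1..n}"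
      unfolding B_def
      by (intro P.indep_vars_iff_distr_eq_PiM'[THEN iffD2])
        (use n cm in \<open>simp_all add: P_def\<close>)
    have sqm: "(\<lambda>\<omega>. (norm (\<omega> i))\<^sup>2) \<in> borel_measurable B" if "i \<in> {1..n}" for i
      by (intro borel_measurable_power measurable_compose[OF _ borel_measurable_norm] cm that)
    have int: "integrable P (\<lambda>\<omega>. (norm (\<omega> i))\<^sup>2)" if "i \<in> {1..n}" for i
      unfolding P_def using Z that by (subst integrable_distr_eq[OF T sqm[OF that]]) (simp add: Ti)
    have mean: "(\<integral>\<omega>. \<omega> i \<partial>P) = 0" if "i \<in> {1..n}" for i
      unfolding P_def using Z that by (subst integral_distr[OF T cm[OF that]]) (simp add: Ti)
    have sq: "(\<integral>\<omega>. (norm (\<omega> i))\<^sup>2 \<partial>P) = (\<integral>\<omega>. (norm (Z i \<omega>))\<^sup>2 \<partial>M)" if "i \<in> {1..n}" for i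
      unfolding P_def using that by (subst integral_distr[OF T sqm[OF that]]) (simp add: Ti)
    have summ: "(\<lambda>\<omega>. (norm (\<Sum>i=1..n. \<omega> i))\<^sup>2) \<in> borel_measurable B"
      by (intro borel_measurable_power measurable_compose[OF _ borel_measurable_norm] borel_measurable_sum cm)
    have "(\<integral>\<omega>. (norm (\<Sum>i=1..n. \<omega> i))\<^sup>2 \<partial>P) = (\<integral>\<omega>. (norm (\<Sum>i=1..n. Z i \<omega>))\<^sup>2 \<partial>M)"
      unfolding P_def by (subst integral_distr[OF T summ]) (simp add: Ti)
    moreover have "(\<Sum>i=1..n. \<integral>\<omega>. (norm (\<omega> i))\<^sup>2 \<partial>P) = (\<Sum>i=1..n. \<integral>\<omega>. (norm (Z i \<omega>))\<^sup>2 \<partial>M)"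
      by (rule sum.cong) (simp_all only: sq)
    moreover have "(\<integral>\<omega>. (norm (\<Sum>i=1..n. \<omega> i))\<^sup>2 \<partial>P) \<le> c * (\<Sum>i=1..n. \<integral>\<omega>. (norm (\<omega> i))\<^sup>2 \<partial>P)"
      by (intro ineq[THEN spec[of _ P], THEN spec[of _ "\<lambda>i \<omega>. \<omega> i"], THEN spec[of _ n],
            THEN mp, THEN mp, THEN mp, THEN mp] n P.prob_space_axioms indepP ballI conjI int mean)
    ultimately show ?thesis by (simp only:)
  qed
  with c show ?thesis by (intro exI[of _ c] conjI allI impI)
qed

end

theory Submission
  imports Defs
begin

text \<open>
  Condition on the design points \<open>X\<^sub>1, \<dots>, X\<^sub>n\<close>. The responses are then independent with laws
  \<open>\<kappa> (X\<^sub>i)\<close>, and \<open>V\<^sub>n\<close> is a sum of independent centred terms with deterministic weights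
  \<open>w\<^sub>i = K\<^sub>i / (\<Sum>\<^sub>j K\<^sub>j)\<close>. Once \<open>h\<^sub>n\<close> is small, only design points with bounded conditional second
  moment get positive weight, so type 2 bounds the conditional second moment of \<open>V\<^sub>n\<close> by a constant
  times \<open>\<Sum>\<^sub>i w\<^sub>i\<^sup>2 \<le> 2 (u / l) / (1 + N)\<close>, where \<open>N\<close> counts the design points in the ball. Finally
  \<open>n \<phi>(x, h\<^sub>n) E [1 / (1 + N)] \<le> 1\<close>.
\<close>

section \<open>Products of kernels and the disintegration of the sample law\<close>

lemma emeasure_PiM_PiE:
  assumes "finite I" and "\<And>i. i \<in> I \<Longrightarrow> prob_space (M i)"
    and "\<And>i. i \<in> I \<Longrightarrow> A i \<in> sets (M i)"
  shows "emeasure (PiM I M) (Pi\<^sub>E I A) = (\<Prod>i\<in>I. emeasure (M i) (A i))"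
  using emeasure_PiM_emb[of I M I A] prod_emb_PiE_same_index[of I A M] assms
  by (simp add: sets.sets_into_space)

text \<open>Boxes form an intersection-stable generator of the product sigma-algebra, and on a box
  the product measure is a finite product of functions, each measurable in one coordinate of
  \<open>xs\<close>.\<close>

lemma measurable_PiM_kernel:
  assumes I: "finite I" and k: "k \<in> S \<rightarrow>\<^sub>M prob_algebra N"
  shows "(\<lambda>xs. \<Pi>\<^sub>M i\<in>I. k (xs i)) \<in> (\<Pi>\<^sub>M i\<in>I. S) \<rightarrow>\<^sub>M prob_algebra (\<Pi>\<^sub>M i\<in>I. N)"
proof -
  have k_prob: "prob_space (k (xs i))" and k_sets: "sets (k (xs i)) = sets N"
    if "xs \<in> space (\<Pi>\<^sub>M i\<in>I. S)" "i \<in> I" for xs i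
    using measurable_space[OF k] that by (auto simp: space_PiM space_prob_algebra PiE_iff)
  show ?thesis
  proof (rule measurable_prob_algebra_generated[OF sets_PiM Int_stable_prod_algebra
        prod_algebra_sets_into_space])
    fix A assume "A \<in> prod_algebra I (\<lambda>_. N)"
    then obtain E where A: "A = Pi\<^sub>E I E" and E: "\<And>i. i \<in> I \<Longrightarrow> E i \<in> sets N"
      by (auto simp: prod_algebra_eq_finite[OF I])
    have "(\<lambda>xs. \<Prod>i\<in>I. emeasure (k (xs i)) (E i)) \<in> borel_measurable (\<Pi>\<^sub>M i\<in>I. S)"
      using measurable_emeasure_kernel[OF measurable_prob_algebraD[OF k]] E
      by (intro borel_measurable_prod_ennreal measurable_compose[OF measurable_component_singleton]) auto
    then show "(\<lambda>xs. emeasure (\<Pi>\<^sub>M i\<in>I. k (xs i)) A) \<in> borel_measurable (\<Pi>\<^sub>M i\<in>I. S)"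
      unfolding A by (subst measurable_cong[OF emeasure_PiM_PiE[OF I]]) (auto simp: k_prob k_sets E)
  qed (auto intro!: prob_space_PiM sets_PiM_cong simp: k_prob k_sets)
qed

text \<open>Both sides agree on boxes: the inner measure factorizes over \<open>i\<close>, and the
  integral of the product splits because the coordinates of \<open>xs\<close> are independent. This
  is what allows conditioning on all design points at once.\<close>

lemma PiM_bind:
  assumes I: "finite I" and \<mu>: "prob_space \<mu>" and k: "k \<in> \<mu> \<rightarrow>\<^sub>M prob_algebra N"
  shows "(\<Pi>\<^sub>M i\<in>I. \<mu> \<bind> k) = (\<Pi>\<^sub>M i\<in>I. \<mu>) \<bind> (\<lambda>xs. \<Pi>\<^sub>M i\<in>I. k (xs i))"
proof -
  have \<mu>_alg: "\<mu> \<in> space (prob_algebra \<mu>)"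
    using \<mu> by (simp add: space_prob_algebra)
  interpret \<mu>: prob_space \<mu> by (rule \<mu>)
  interpret bind: prob_space "\<mu> \<bind> k"
    by (rule prob_space_bind'[OF \<mu>_alg k])
  interpret P: product_prob_space "\<lambda>_. \<mu>" I ..
  interpret B: product_prob_space "\<lambda>_. \<mu> \<bind> k" I ..
  note sets_bind_k = sets_bind'[OF \<mu>_alg k]
  note k_PiM = measurable_PiM_kernel[OF I k]
  have P_alg: "(\<Pi>\<^sub>M i\<in>I. \<mu>) \<in> space (prob_algebra (\<Pi>\<^sub>M i\<in>I. \<mu>))"
    using P.prob_space_axioms by (simp add: space_prob_algebra)
  show ?thesis
  proof (rule B.PiM_eqI[symmetric, OF I])
    show "sets ((\<Pi>\<^sub>M i\<in>I. \<mu>) \<bind> (\<lambda>xs. \<Pi>\<^sub>M i\<in>I. k (xs i))) = sets (\<Pi>\<^sub>M i\<in>I. \<mu> \<bind> k)"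
      unfolding sets_bind'[OF P_alg k_PiM] by (intro sets_PiM_cong) (simp_all add: sets_bind_k)
    fix A assume "\<And>i. i \<in> I \<Longrightarrow> A i \<in> sets (\<mu> \<bind> k)"
    then have A: "A i \<in> sets N" if "i \<in> I" for i
      using that sets_bind_k by simp
    have "emeasure ((\<Pi>\<^sub>M i\<in>I. \<mu>) \<bind> (\<lambda>xs. \<Pi>\<^sub>M i\<in>I. k (xs i))) (Pi\<^sub>E I A) =
        (\<integral>\<^sup>+xs. emeasure (\<Pi>\<^sub>M i\<in>I. k (xs i)) (Pi\<^sub>E I A) \<partial>(\<Pi>\<^sub>M i\<in>I. \<mu>))"
      using A I by (intro emeasure_bind_prob_algebra[OF P_alg k_PiM] sets_PiM_I_finite) auto
    also have "\<dots> = (\<integral>\<^sup>+xs. (\<Prod>i\<in>I. emeasure (k (xs i)) (A i)) \<partial>(\<Pi>\<^sub>M i\<in>I. \<mu>))"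
    proof (rule nn_integral_cong)
      fix xs assume "xs \<in> space (\<Pi>\<^sub>M i\<in>I. \<mu>)"
      then show "emeasure (\<Pi>\<^sub>M i\<in>I. k (xs i)) (Pi\<^sub>E I A) = (\<Prod>i\<in>I. emeasure (k (xs i)) (A i))"
        using measurable_space[OF k] A
        by (intro emeasure_PiM_PiE[OF I]) (auto simp: space_PiM space_prob_algebra PiE_iff)
    qed
    also have "\<dots> = (\<Prod>i\<in>I. \<integral>\<^sup>+z. emeasure (k z) (A i) \<partial>\<mu>)"
      using measurable_emeasure_kernel[OF measurable_prob_algebraD[OF k]] A
      by (intro P.product_nn_integral_prod I) auto
    also have "\<dots> = (\<Prod>i\<in>I. emeasure (\<mu> \<bind> k) (A i))"
      using A by (intro prod.cong) (simp_all add: emeasure_bind_prob_algebra[OF \<mu>_alg k])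
    finally show "emeasure ((\<Pi>\<^sub>M i\<in>I. \<mu>) \<bind> (\<lambda>xs. \<Pi>\<^sub>M i\<in>I. k (xs i))) (Pi\<^sub>E I A) =
        (\<Prod>i\<in>I. emeasure (\<mu> \<bind> k) (A i))" .
  qed
qed

lemma measurable_distr_Pair_kernel:
  assumes "\<kappa> \<in> S \<rightarrow>\<^sub>M prob_algebra R"
  shows "(\<lambda>z. distr (\<kappa> z) (S \<Otimes>\<^sub>M R) (Pair z)) \<in> S \<rightarrow>\<^sub>M prob_algebra (S \<Otimes>\<^sub>M R)"
  using assms by (intro measurable_distr_prob_space2[where M = R]) auto

text \<open>The defining identity of \<open>regular_cond_distr\<close> is agreement on measurable
  rectangles, which determines a probability measure on the product. Mapping by
  \<open>Pair z\<close> carries \<open>z\<close> along, so that a draw yields a design point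
  together with its response.\<close>

lemma regular_cond_distr_disintegration:
  assumes M: "prob_space M" and X: "X \<in> M \<rightarrow>\<^sub>M S" and Y: "Y \<in> M \<rightarrow>\<^sub>M R"
    and reg: "regular_cond_distr M S R X Y \<kappa>"
  shows "distr M (S \<Otimes>\<^sub>M R) (\<lambda>\<omega>. (X \<omega>, Y \<omega>)) =
    distr M S X \<bind> (\<lambda>z. distr (\<kappa> z) (S \<Otimes>\<^sub>M R) (Pair z))"
proof (rule measure_eqI_generator_eq[OF Int_stable_pair_measure_generator[of S R],
      where A = "\<lambda>_. space S \<times> space R"])
  interpret M: prob_space M by (rule M)
  have \<kappa>: "\<kappa> \<in> S \<rightarrow>\<^sub>M prob_algebra R"
    using reg by (auto simp: regular_cond_distr_def)
  let ?k = "\<lambda>z. distr (\<kappa> z) (S \<Otimes>\<^sub>M R) (Pair z)"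
  note k = measurable_distr_Pair_kernel[OF \<kappa>]
  have X_alg: "distr M S X \<in> space (prob_algebra S)"
    using M.prob_space_distr[OF X] by (simp add: space_prob_algebra)
  let ?J = "distr M (S \<Otimes>\<^sub>M R) (\<lambda>\<omega>. (X \<omega>, Y \<omega>))"
  have XY: "(\<lambda>\<omega>. (X \<omega>, Y \<omega>)) \<in> M \<rightarrow>\<^sub>M S \<Otimes>\<^sub>M R"
    by (rule measurable_Pair[OF X Y])
  have J: "prob_space ?J"
    by (rule M.prob_space_distr[OF XY])
  show "{a \<times> b |a b. a \<in> sets S \<and> b \<in> sets R} \<subseteq> Pow (space S \<times> space R)"
    using sets.space_closed[of S] sets.space_closed[of R] by auto
  show "sets ?J = sigma_sets (space S \<times> space R) {a \<times> b |a b. a \<in> sets S \<and> b \<in> sets R}"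
    by (simp add: sets_pair_measure)
  show "sets (distr M S X \<bind> ?k) =
      sigma_sets (space S \<times> space R) {a \<times> b |a b. a \<in> sets S \<and> b \<in> sets R}"
    unfolding sets_bind'[OF X_alg k] by (simp add: sets_pair_measure)
  \<comment> \<open>The whole space is itself a rectangle of finite measure, so the constant
    sequence exhausts it.\<close>
  show "range (\<lambda>_::nat. space S \<times> space R) \<subseteq> {a \<times> b |a b. a \<in> sets S \<and> b \<in> sets R}"
    by blast
  show "(\<Union>i::nat. space S \<times> space R) = space S \<times> space R" by simp
  show "emeasure ?J (space S \<times> space R) \<noteq> \<infinity>" for i :: nat
    using prob_space.emeasure_space_1[OF J] by (simp add: space_pair_measure)
  fix C assume "C \<in> {a \<times> b |a b. a \<in> sets S \<and> b \<in> sets R}"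
  then obtain A B where C: "C = A \<times> B" and A: "A \<in> sets S" and B: "B \<in> sets R"
    by blast
  have "emeasure (distr M S X \<bind> ?k) C = (\<integral>\<^sup>+z. emeasure (?k z) C \<partial>distr M S X)"
    unfolding C using A B by (intro emeasure_bind_prob_algebra[OF X_alg k]) auto
  also have "\<dots> = (\<integral>\<^sup>+z\<in>A. emeasure (\<kappa> z) B \<partial>distr M S X)"
  proof (rule nn_integral_cong)
    fix z assume "z \<in> space (distr M S X)"
    then have z: "z \<in> space S" by simp
    then have sets_\<kappa>: "sets (\<kappa> z) = sets R"
      using measurable_space[OF \<kappa>] by (auto simp: space_prob_algebra)
    then have "Pair z \<in> \<kappa> z \<rightarrow>\<^sub>M S \<Otimes>\<^sub>M R"
      using z by (simp add: measurable_Pair1' cong: measurable_cong_sets)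
    \<comment> \<open>The preimage of \<open>A \<times> B\<close> under \<open>Pair z\<close> is
      \<open>B\<close> when \<open>z\<close> lies in \<open>A\<close> and empty otherwise; hence the
      indicator.\<close>
    then show "emeasure (?k z) C = emeasure (\<kappa> z) B * indicator A z"
      using A B sets.sets_into_space[of B "\<kappa> z"]
      by (auto simp: C emeasure_distr sets_\<kappa> vimage_def Int_absorb2 Int_def[symmetric] indicator_def
        intro!: arg_cong[where f = "emeasure (\<kappa> z)"])
  qed
  also have "\<dots> = emeasure M {\<omega> \<in> space M. X \<omega> \<in> A \<and> Y \<omega> \<in> B}"
    using reg A B by (auto simp: regular_cond_distr_def)
  also have "\<dots> = emeasure ?J C"
    unfolding C using A B X Y
    by (subst emeasure_distr) (auto intro!: arg_cong[where f = "emeasure M"])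
  finally show "emeasure ?J C = emeasure (distr M S X \<bind> ?k) C" by simp
qed

section \<open>The expected reciprocal of the number of points in a set\<close>

text \<open>
  Instead of evaluating binomial moments: for each \<open>i\<close>, independence of \<open>xs i\<close> from the other
  coordinates bounds \<open>\<mu> A * E [1 / (1 + N)]\<close> by \<open>E [indicator A (xs i) / N]\<close>, and these ratios sum
  to at most \<open>1\<close> over \<open>i\<close>.
\<close>

lemma nn_integral_inverse_Suc_count_le:
  fixes \<mu> :: "'a measure" and I :: "'i set"
  assumes \<mu>: "prob_space \<mu>" and I: "finite I" and A: "A \<in> sets \<mu>"
  shows "of_nat (card I) * emeasure \<mu> A *
    (\<integral>\<^sup>+xs. ennreal (1 / (1 + (\<Sum>i\<in>I. indicator A (xs i)))) \<partial>(\<Pi>\<^sub>M i\<in>I. \<mu>)) \<le> 1"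
proof -
  interpret \<mu>: prob_space \<mu> by (rule \<mu>)
  interpret P: product_prob_space "\<lambda>_. \<mu>" I ..
  let ?P = "\<lambda>J. \<Pi>\<^sub>M i\<in>J. \<mu>"
  let ?N = "\<lambda>J (xs :: 'i \<Rightarrow> 'a). \<Sum>i\<in>J. indicator A (xs i) :: real"
  let ?Q = "\<lambda>J. \<integral>\<^sup>+xs. ennreal (1 / (1 + ?N J xs)) \<partial>?P J"
  note [measurable] = A
  have N_nonneg: "?N J xs \<ge> 0" for J xs
    by (intro sum_nonneg) auto
  have meas [measurable]: "?N J \<in> borel_measurable (?P J')" if "J \<subseteq> J'" for J J'
    using that by (intro borel_measurable_sum measurable_compose[OF measurable_component_singleton]) auto
  have *: "emeasure \<mu> A * ?Q I \<le> (\<integral>\<^sup>+xs. ennreal (indicator A (xs i) / ?N I xs) \<partial>?P I)"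
    if i: "i \<in> I" for i
  proof -
    define J where "J = I - {i}"
    have J: "finite J" "i \<notin> J" and I_eq: "I = insert i J"
      using i I by (auto simp: J_def)
    have N_upd: "?N I (xs(i := y)) = indicator A y + ?N J xs" for xs y
    proof -
      have "?N J (xs(i := y)) = ?N J xs"
        using J by (intro sum.cong) auto
      then show ?thesis
        unfolding I_eq using J by simp
    qed
    \<comment> \<open>Integrate coordinate \<open>i\<close> separately, then drop its indicator from
      the denominator; what remains depends only on the coordinates in \<open>J\<close>.\<close>
    have "?Q I = (\<integral>\<^sup>+xs. (\<integral>\<^sup>+y. ennreal (1 / (1 + ?N I (xs(i := y)))) \<partial>\<mu>) \<partial>?P J)"
      using J unfolding I_eq by (intro P.product_nn_integral_insert) auto
    also have "\<dots> \<le> (\<integral>\<^sup>+xs. (\<integral>\<^sup>+y. ennreal (1 / (1 + ?N J xs)) \<partial>\<mu>) \<partial>?P J)"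
      using N_nonneg unfolding N_upd
      by (intro nn_integral_mono ennreal_leI divide_left_mono mult_pos_pos add_pos_nonneg) auto
    also have "\<dots> = ?Q J"
      by (simp add: \<mu>.emeasure_space_1)
    finally have "emeasure \<mu> A * ?Q I \<le> emeasure \<mu> A * ?Q J"
      by (rule mult_left_mono) simp
    \<comment> \<open>The factor \<open>emeasure \<mu> A\<close> is the integral of the indicator of
      a fresh coordinate \<open>y\<close>, independent of those in \<open>J\<close>.\<close>
    also have "\<dots> = (\<integral>\<^sup>+xs. (\<integral>\<^sup>+y. indicator A y * ennreal (1 / (1 + ?N J xs)) \<partial>\<mu>) \<partial>?P J)"
      by (simp add: nn_integral_multc nn_integral_cmult)
    \<comment> \<open>For \<open>y\<close> in \<open>A\<close> the denominator
      \<open>1 + ?N J xs\<close> is exactly the full count; for other \<open>y\<close> both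
      integrands are 0.\<close>
    also have "\<dots> = (\<integral>\<^sup>+xs. (\<integral>\<^sup>+y. ennreal (indicator A ((xs(i := y)) i) / ?N I (xs(i := y))) \<partial>\<mu>) \<partial>?P J)"
      unfolding N_upd by (intro nn_integral_cong) (auto simp: indicator_def)
    also have "\<dots> = (\<integral>\<^sup>+xs. ennreal (indicator A (xs i) / ?N I xs) \<partial>?P I)"
      using J unfolding I_eq by (intro P.product_nn_integral_insert[symmetric]) auto
    finally show ?thesis .
  qed
  have "of_nat (card I) * emeasure \<mu> A * ?Q I = (\<Sum>i\<in>I. emeasure \<mu> A * ?Q I)"
    by (simp add: mult.assoc)
  also have "\<dots> \<le> (\<Sum>i\<in>I. \<integral>\<^sup>+xs. ennreal (indicator A (xs i) / ?N I xs) \<partial>?P I)"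
    by (intro sum_mono *)
  also have "\<dots> = (\<integral>\<^sup>+xs. (\<Sum>i\<in>I. ennreal (indicator A (xs i) / ?N I xs)) \<partial>?P I)"
    by (intro nn_integral_sum[symmetric]) measurable
  also have "\<dots> = (\<integral>\<^sup>+xs. ennreal (?N I xs / ?N I xs) \<partial>?P I)"
    using N_nonneg by (intro nn_integral_cong) (simp add: sum_divide_distrib[symmetric])
  \<comment> \<open>The ratio is 1, except for count 0, where division by zero gives 0.\<close>
  also have "\<dots> \<le> (\<integral>\<^sup>+xs. 1 \<partial>?P I)"
    by (intro nn_integral_mono) (auto simp: ennreal_le_1)
  also have "\<dots> = 1"
    by (simp add: P.P.emeasure_space_1)
  finally show ?thesis .
qed

section \<open>Conditional moments and the type 2 inequality on product spaces\<close>

lemma power2_le_1_plus_powr: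
  fixes t \<nu> :: real
  assumes "0 \<le> t" and "2 \<le> \<nu>"
  shows "t\<^sup>2 \<le> 1 + t powr \<nu>"
proof (cases "t \<le> 1")
  case True
  then have "t\<^sup>2 \<le> 1"
    using assms by (simp add: power_le_one)
  then show ?thesis
    by (simp add: add_increasing2)
next
  case False
  then have "t\<^sup>2 = t powr 2"
    by simp
  also have "\<dots> \<le> t powr \<nu>"
    using False assms by (intro powr_mono) auto
  finally show ?thesis by simp
qed

text \<open>
  The centre \<open>a\<close> is arbitrary, so the lemma covers \<open>a = cond_mean \<kappa> G z\<close> before \<open>G\<close> is known to be
  integrable, that is, when the conditional mean could still be the junk value \<open>0\<close>.
\<close>

lemma central_second_moment_le:
  fixes G :: "'a \<Rightarrow> 'g::{banach, second_countable_topology}"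
  assumes P: "prob_space P" and G: "G \<in> borel_measurable P" and \<nu>: "2 \<le> \<nu>" and C: "0 \<le> C"
    and le: "(\<integral>\<^sup>+y. ennreal (norm (G y - a) powr \<nu>) \<partial>P) \<le> ennreal C"
  shows "integrable P G" and "(\<integral>\<^sup>+y. ennreal ((norm (G y - a))\<^sup>2) \<partial>P) \<le> ennreal (1 + C)"
proof -
  interpret P: prob_space P by (rule P)
  note [measurable] = G
  have "(\<integral>\<^sup>+y. ennreal ((norm (G y - a))\<^sup>2) \<partial>P) \<le> (\<integral>\<^sup>+y. 1 + ennreal (norm (G y - a) powr \<nu>) \<partial>P)"
    using power2_le_1_plus_powr[OF norm_ge_zero \<nu>]
    by (intro nn_integral_mono) (simp flip: ennreal_1 ennreal_plus)
  also have "\<dots> \<le> 1 + ennreal C"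
    using le by (simp add: nn_integral_add P.emeasure_space_1)
  also have "\<dots> = ennreal (1 + C)"
    using C by simp
  finally show *: "(\<integral>\<^sup>+y. ennreal ((norm (G y - a))\<^sup>2) \<partial>P) \<le> ennreal (1 + C)" .
  have "(\<integral>\<^sup>+y. ennreal (norm (G y - a)) \<partial>P) \<le> (\<integral>\<^sup>+y. 1 + ennreal ((norm (G y - a))\<^sup>2) \<partial>P)"
  proof (intro nn_integral_mono)
    fix y
    \<comment> \<open>With \<open>t\<close> the norm, \<open>(t - 1)\<^sup>2 \<ge> 0\<close> gives
      \<open>2 * t \<le> 1 + t\<^sup>2\<close>, and \<open>t \<le> 2 * t\<close>.\<close>
    have "norm (G y - a) \<le> 1 + (norm (G y - a))\<^sup>2"
      using zero_le_power2[of "norm (G y - a) - 1"] norm_ge_zero[of "G y - a"]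
      unfolding power2_diff by (simp del: norm_ge_zero)
    then show "ennreal (norm (G y - a)) \<le> 1 + ennreal ((norm (G y - a))\<^sup>2)"
      by (simp flip: ennreal_1 ennreal_plus)
  qed
  also have "\<dots> \<le> 1 + ennreal (1 + C)"
    using * by (simp add: nn_integral_add P.emeasure_space_1)
  also have "\<dots> < \<infinity>"
    by (simp add: less_top)
  finally have "integrable P (\<lambda>y. G y - a)"
    by (intro integrableI_bounded) auto
  then have "integrable P (\<lambda>y. (G y - a) + a)"
    by (intro Bochner_Integration.integrable_add) auto
  then show "integrable P G"
    by simp
qed

text \<open>Functions of distinct coordinates are independent under \<open>PiM\<close>, so type 2
  applies to them; the sample type \<open>nat \<Rightarrow> 'a\<close> of the hypothesis is that of
  the product space. With nonnegative integrals, the finite bounds \<open>b i\<close> also supply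
  square integrability.\<close>

lemma type_2_sum_PiM:
  fixes f :: "nat \<Rightarrow> 'a \<Rightarrow> 'b::{banach, second_countable_topology}"
  assumes type_2_ineq: "\<forall>(M :: (nat \<Rightarrow> 'a) measure) (Z :: nat \<Rightarrow> (nat \<Rightarrow> 'a) \<Rightarrow> 'b) n.
        n \<ge> 1 \<longrightarrow> prob_space M \<longrightarrow>
        prob_space.indep_vars M (\<lambda>_. borel) Z {1..n} \<longrightarrow>
        (\<forall>i\<in>{1..n}. integrable M (\<lambda>\<omega>. (norm (Z i \<omega>))\<^sup>2) \<and> (\<integral>\<omega>. Z i \<omega> \<partial>M) = 0) \<longrightarrow>
        (\<integral>\<omega>. (norm (\<Sum>i=1..n. Z i \<omega>))\<^sup>2 \<partial>M) \<le> c * (\<Sum>i=1..n. \<integral>\<omega>. (norm (Z i \<omega>))\<^sup>2 \<partial>M)"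
    and c: "0 \<le> c" and n: "n \<ge> 1"
    and P: "\<And>i. i \<in> {1..n} \<Longrightarrow> prob_space (P i)"
    and f: "\<And>i. i \<in> {1..n} \<Longrightarrow> f i \<in> borel_measurable (P i)"
    and mean: "\<And>i. i \<in> {1..n} \<Longrightarrow> (\<integral>y. f i y \<partial>P i) = 0"
    and b: "\<And>i. i \<in> {1..n} \<Longrightarrow> 0 \<le> b i"
    and moment: "\<And>i. i \<in> {1..n} \<Longrightarrow> (\<integral>\<^sup>+y. ennreal ((norm (f i y))\<^sup>2) \<partial>P i) \<le> ennreal (b i)"
  shows "(\<integral>\<^sup>+p. ennreal ((norm (\<Sum>i=1..n. f i (p i)))\<^sup>2) \<partial>PiM {1..n} P) \<le> ennreal (c * (\<Sum>i=1..n. b i))"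
proof -
  let ?Q = "PiM {1..n} P"
  interpret Q: prob_space ?Q
    by (rule prob_space_PiM) (rule P)
  have coord: "(\<lambda>p. p i) \<in> ?Q \<rightarrow>\<^sub>M P i" if "i \<in> {1..n}" for i
    using that by (rule measurable_component_singleton)
  have marg: "distr ?Q (P i) (\<lambda>p. p i) = P i" if "i \<in> {1..n}" for i
    using P that by (rule distr_PiM_component)
  have fm [measurable]: "(\<lambda>p. f i (p i)) \<in> borel_measurable ?Q" if "i \<in> {1..n}" for i
    using measurable_compose[OF coord f] that by blast
  \<comment> \<open>Points of the product space are extensional, so restriction to
    \<open>{1..n}\<close> changes nothing. The joint law of the coordinates is thus the product of
    their laws, which characterizes independence.\<close>
  have "distr ?Q ?Q (\<lambda>p. \<lambda>i\<in>{1..n}. p i) = distr ?Q ?Q (\<lambda>p. p)"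
    by (intro distr_cong) (auto simp: space_PiM PiE_iff intro!: extensional_restrict)
  also have "\<dots> = ?Q"
    by (rule distr_id)
  also have "\<dots> = (\<Pi>\<^sub>M i\<in>{1..n}. distr ?Q (P i) (\<lambda>p. p i))"
    by (intro PiM_cong refl marg[symmetric])
  finally have "Q.indep_vars P (\<lambda>i p. p i) {1..n}"
    using n coord by (subst Q.indep_vars_iff_distr_eq_PiM') auto
  then have indep: "Q.indep_vars (\<lambda>_. borel) (\<lambda>i p. f i (p i)) {1..n}"
    by (rule Q.indep_vars_compose2) (rule f)
  have sq_eq: "(\<integral>\<^sup>+p. ennreal ((norm (f i (p i)))\<^sup>2) \<partial>?Q) = (\<integral>\<^sup>+y. ennreal ((norm (f i y))\<^sup>2) \<partial>P i)"
    if i: "i \<in> {1..n}" for i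
  proof -
    note [measurable] = f[OF i]
    show ?thesis
      by (subst marg[OF i, symmetric], subst nn_integral_distr[OF coord[OF i]]) measurable
  qed
  have sq_le: "(\<integral>\<^sup>+p. ennreal ((norm (f i (p i)))\<^sup>2) \<partial>?Q) \<le> ennreal (b i)" if "i \<in> {1..n}" for i
    using moment sq_eq that by simp
  have int: "integrable ?Q (\<lambda>p. (norm (f i (p i)))\<^sup>2)" if i: "i \<in> {1..n}" for i
    using sq_le[OF i] fm[OF i] by (intro integrableI_nonneg) (auto intro: le_less_trans)
  have int_le: "(\<integral>p. (norm (f i (p i)))\<^sup>2 \<partial>?Q) \<le> b i" if i: "i \<in> {1..n}" for i
    using sq_le[OF i] nn_integral_eq_integral[OF int[OF i]] b[OF i] by (simp del: One_nat_def)
  have mean0: "(\<integral>p. f i (p i) \<partial>?Q) = 0" if i: "i \<in> {1..n}" for i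
    using mean[OF i] integral_distr[OF coord[OF i] f[OF i]] by (simp add: marg[OF i] del: One_nat_def)
  \<comment> \<open>A crude Cauchy-Schwarz bound. It serves to make the squared norm of the sum
    integrable; its factor \<open>n\<close> does not enter the final estimate.\<close>
  have norm_sum_le: "(norm (\<Sum>i=1..n. v i))\<^sup>2 \<le> real n * (\<Sum>i=1..n. (norm (v i))\<^sup>2)" for v :: "nat \<Rightarrow> 'b"
  proof -
    have "(norm (\<Sum>i=1..n. v i))\<^sup>2 \<le> (\<Sum>i=1..n. norm (v i))\<^sup>2"
      by (intro power_mono norm_sum) simp
    also have "\<dots> \<le> real n * (\<Sum>i=1..n. (norm (v i))\<^sup>2)"
      using sum_squared_le_sum_of_squares[of "\<lambda>i. norm (v i)" "{1..n}"]
      by (simp add: mult.commute)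
    finally show ?thesis .
  qed
  have "integrable ?Q (\<lambda>p. real n * (\<Sum>i=1..n. (norm (f i (p i)))\<^sup>2))"
    by (intro integrable_mult_right Bochner_Integration.integrable_sum int)
  then have int_sum: "integrable ?Q (\<lambda>p. (norm (\<Sum>i=1..n. f i (p i)))\<^sup>2)"
  proof (rule Bochner_Integration.integrable_bound)
    show "AE p in ?Q. norm ((norm (\<Sum>i=1..n. f i (p i)))\<^sup>2) \<le>
        norm (real n * (\<Sum>i=1..n. (norm (f i (p i)))\<^sup>2))"
      using norm_sum_le by (auto simp: sum_nonneg)
  qed measurable
  have "(\<integral>p. (norm (\<Sum>i=1..n. f i (p i)))\<^sup>2 \<partial>?Q) \<le> c * (\<Sum>i=1..n. \<integral>p. (norm (f i (p i)))\<^sup>2 \<partial>?Q)"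
    using type_2_ineq n Q.prob_space_axioms indep int mean0 by blast
  also have "\<dots> \<le> c * (\<Sum>i=1..n. b i)"
    using c int_le by (intro mult_left_mono sum_mono)
  finally show ?thesis
    by (subst nn_integral_eq_integral[OF int_sum]) (auto intro: ennreal_leI)
qed

section \<open>Kernel weights and the second moment for a fixed design\<close>

text \<open>With \<open>s\<close> the sum of the \<open>a i\<close> and \<open>N\<close> the count,
  \<open>(a i)\<^sup>2 \<le> u * a i\<close> bounds the left side by \<open>u / s\<close>, and
  \<open>s \<ge> l * N\<close> applies. The shape \<open>1 / (1 + N)\<close> stays meaningful for
  \<open>N = 0\<close> and is the one whose expectation
  \<open>nn_integral_inverse_Suc_count_le\<close> controls.\<close>

lemma sum_normalized_weights_power2_le:
  fixes a :: "'i \<Rightarrow> real"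
  assumes I: "finite I" and l: "0 < l" and u: "0 \<le> u"
    and inside: "\<And>i. i \<in> I \<Longrightarrow> z i \<in> A \<Longrightarrow> l \<le> a i \<and> a i \<le> u"
    and outside: "\<And>i. i \<in> I \<Longrightarrow> z i \<notin> A \<Longrightarrow> a i = 0"
  shows "(\<Sum>i\<in>I. (a i / (\<Sum>j\<in>I. a j))\<^sup>2) \<le> 2 * u / l * (1 / (1 + (\<Sum>i\<in>I. indicator A (z i))))"
proof -
  define N where "N = (\<Sum>i\<in>I. indicator A (z i) :: real)"
  define s where "s = (\<Sum>i\<in>I. a i)"
  have N_card: "N = real (card {i \<in> I. z i \<in> A})"
    using I by (simp add: N_def indicator_def sum.If_cases Int_def)
  have "l * N \<le> s"
    unfolding N_def s_def sum_distrib_left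
    using inside outside by (intro sum_mono) (auto simp: indicator_def)
  have a_sq: "(a i)\<^sup>2 \<le> u * a i" if "i \<in> I" for i
  proof (cases "z i \<in> A")
    case True
    then show ?thesis
      using inside[OF that] l by (simp add: power2_eq_square mult_right_mono)
  qed (simp add: outside that)
  show ?thesis
  proof (cases "N = 0")
    case True
    then have "a i = 0" if "i \<in> I" for i
      using outside[OF that] that I unfolding N_card by auto
    then show ?thesis
      using l u by (simp add: sum_nonneg)
  next
    case False
    then have N: "1 \<le> N"
      unfolding N_card by (simp add: Suc_le_eq)
    then have "0 < l * N"
      using l by simp
    then have s: "0 < s"
      using \<open>l * N \<le> s\<close> by linarith
    have "(\<Sum>i\<in>I. (a i / s)\<^sup>2) = (\<Sum>i\<in>I. (a i)\<^sup>2) / s\<^sup>2"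
      by (simp add: power_divide sum_divide_distrib)
    also have "\<dots> \<le> (u * s) / s\<^sup>2"
      using a_sq unfolding s_def sum_distrib_left by (intro divide_right_mono sum_mono) auto
    also have "\<dots> = u / s"
      using s by (simp add: power2_eq_square)
    also have "\<dots> \<le> u / (l * N)"
      using \<open>l * N \<le> s\<close> \<open>0 < l * N\<close> u by (intro divide_left_mono) auto
    also have "\<dots> = u / l * (1 / N)"
      by simp
    \<comment> \<open>A nonzero count is at least 1, so \<open>1 / N \<le> 2 / (1 + N)\<close>; this
      is the source of the factor 2.\<close>
    also have "\<dots> \<le> u / l * (2 / (1 + N))"
      using N l u by (intro mult_left_mono) (auto simp: field_simps)
    finally show ?thesis
      by (simp add: N_def s_def mult.commute)
  qed
qed

text \<open>\<open>\<omega>\<close> and \<open>\<omega>'\<close> may come from different sample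
  spaces. This moves the statistic from \<open>M\<close> to the product space of pairs, and there
  replaces the random design points by their almost sure values.\<close>

lemma V_stat_cong:
  assumes "\<And>i. i \<in> {1..n} \<Longrightarrow> Xs i \<omega> = Xs' i \<omega>'" and "\<And>i. i \<in> {1..n} \<Longrightarrow> Ys i \<omega> = Ys' i \<omega>'"
  shows "V_stat L G \<kappa> K h x Xs Ys n \<omega> = V_stat L G \<kappa> K h x Xs' Ys' n \<omega>'"
  unfolding V_stat_def
  by (intro arg_cong[where f = L] arg_cong2[where f = scaleR] arg_cong[where f = inverse] sum.cong refl)
     (simp_all only: assms)

text \<open>Under the product law the design points are almost surely \<open>xs i\<close>, so the
  statistic is a sum of independent centred terms with constant weights, to which type 2 applies.
  Integrability and the moment bound are asked only where the kernel is nonzero, because they will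
  be available only near \<open>x\<close>.\<close>

lemma nn_integral_V_stat_fixed_design_le:
  fixes G :: "'r \<Rightarrow> 'g::{banach, second_countable_topology}"
    and L :: "'g \<Rightarrow> 'b::{banach, second_countable_topology}"
    and xs :: "nat \<Rightarrow> 'c::polish_space"
  assumes type_2_ineq: "\<forall>(M :: (nat \<Rightarrow> 'c \<times> 'r) measure) (Z :: nat \<Rightarrow> (nat \<Rightarrow> 'c \<times> 'r) \<Rightarrow> 'b) n.
        n \<ge> 1 \<longrightarrow> prob_space M \<longrightarrow>
        prob_space.indep_vars M (\<lambda>_. borel) Z {1..n} \<longrightarrow>
        (\<forall>i\<in>{1..n}. integrable M (\<lambda>\<omega>. (norm (Z i \<omega>))\<^sup>2) \<and> (\<integral>\<omega>. Z i \<omega> \<partial>M) = 0) \<longrightarrow>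
        (\<integral>\<omega>. (norm (\<Sum>i=1..n. Z i \<omega>))\<^sup>2 \<partial>M) \<le> c * (\<Sum>i=1..n. \<integral>\<omega>. (norm (Z i \<omega>))\<^sup>2 \<partial>M)"
    and c: "0 \<le> c" and n: "n \<ge> 1"
    and \<kappa>: "\<kappa> \<in> borel \<rightarrow>\<^sub>M prob_algebra R" and G: "G \<in> borel_measurable R"
    and L: "bounded_linear L" and C: "0 \<le> C"
    and int: "\<And>i. i \<in> {1..n} \<Longrightarrow> K (dist x (xs i) / h n) \<noteq> 0 \<Longrightarrow> integrable (\<kappa> (xs i)) G"
    and moment: "\<And>i. i \<in> {1..n} \<Longrightarrow> K (dist x (xs i) / h n) \<noteq> 0 \<Longrightarrow>
      (\<integral>\<^sup>+y. ennreal ((norm (G y - cond_mean \<kappa> G (xs i)))\<^sup>2) \<partial>\<kappa> (xs i)) \<le> ennreal C"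
  shows "(\<integral>\<^sup>+p. ennreal ((norm (V_stat L G \<kappa> K h x (\<lambda>i p. fst (p i)) (\<lambda>i p. snd (p i)) n p))\<^sup>2)
        \<partial>(\<Pi>\<^sub>M i\<in>{1..n}. distr (\<kappa> (xs i)) (borel \<Otimes>\<^sub>M R) (Pair (xs i))))
    \<le> ennreal (c * ((onorm L)\<^sup>2 * C *
        (\<Sum>i=1..n. (K (dist x (xs i) / h n) / (\<Sum>j=1..n. K (dist x (xs j) / h n)))\<^sup>2)))"
proof -
  interpret L: bounded_linear L by (rule L)
  define a where "a = (\<lambda>i. K (dist x (xs i) / h n))"
  define w where "w = (\<lambda>i. a i / (\<Sum>j=1..n. a j))"
  define P where "P = (\<lambda>i. distr (\<kappa> (xs i)) (borel \<Otimes>\<^sub>M R) (Pair (xs i)))"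
  define D where "D = (\<lambda>i y. G y - cond_mean \<kappa> G (xs i))"
  \<comment> \<open>The weight and the centre are taken from the constant \<open>xs i\<close>
    instead of the first component of \<open>q\<close>; the two agree almost everywhere.\<close>
  define f where "f = (\<lambda>i (q :: 'c \<times> 'r). w i *\<^sub>R L (D i (snd q)))"
  have \<kappa>_prob: "prob_space (\<kappa> z)" and \<kappa>_sets: "sets (\<kappa> z) = sets R" for z
    using measurable_space[OF \<kappa>] by (auto simp: space_prob_algebra)
  have Pair_m: "Pair z \<in> \<kappa> z \<rightarrow>\<^sub>M borel \<Otimes>\<^sub>M R" for z
    by (simp add: \<kappa>_sets cong: measurable_cong_sets)
  have P_prob: "prob_space (P i)" for i
    unfolding P_def by (intro prob_space.prob_space_distr \<kappa>_prob Pair_m)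
  have D_m: "D i \<in> borel_measurable R" for i
    unfolding D_def using G by measurable
  have LD_m: "(\<lambda>y. L (D i y)) \<in> borel_measurable R" for i
    by (rule measurable_compose[OF D_m borel_measurable_continuous_onI[OF linear_continuous_on[OF L]]])
  have f_m: "f i \<in> borel_measurable (borel \<Otimes>\<^sub>M R)" for i
    unfolding f_def by (intro borel_measurable_scaleR measurable_compose[OF measurable_snd LD_m]) auto
  \<comment> \<open>A zero kernel value makes \<open>f i\<close> the zero function, so mean and
    moment are trivial there, whatever \<open>G\<close> does under
    \<open>\<kappa> (xs i)\<close>.\<close>
  have w0: "f i = (\<lambda>_. 0)" if "a i = 0" for i
    using that by (simp add: f_def w_def)
  have f_mean: "(\<integral>q. f i q \<partial>P i) = 0" if i: "i \<in> {1..n}" for i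
  proof (cases "a i = 0")
    case False
    interpret \<kappa>: prob_space "\<kappa> (xs i)" by (rule \<kappa>_prob)
    have intG: "integrable (\<kappa> (xs i)) G"
      using int[OF i] False by (simp add: a_def)
    then have D0: "(\<integral>y. D i y \<partial>\<kappa> (xs i)) = 0"
      by (simp add: D_def cond_mean_def \<kappa>.prob_space)
    have intD: "integrable (\<kappa> (xs i)) (D i)"
      unfolding D_def using intG by simp
    have "(\<integral>q. f i q \<partial>P i) = (\<integral>y. w i *\<^sub>R L (D i y) \<partial>\<kappa> (xs i))"
      unfolding P_def by (subst integral_distr[OF Pair_m f_m]) (simp add: f_def)
    also have "\<dots> = w i *\<^sub>R L (\<integral>y. D i y \<partial>\<kappa> (xs i))"
      by (simp add: integral_bounded_linear[OF L intD])
    finally show ?thesis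
      by (simp add: D0 L.zero)
  qed (simp add: w0)
  have f_moment: "(\<integral>\<^sup>+q. ennreal ((norm (f i q))\<^sup>2) \<partial>P i) \<le> ennreal ((w i)\<^sup>2 * ((onorm L)\<^sup>2 * C))"
    if i: "i \<in> {1..n}" for i
  proof (cases "a i = 0")
    case False
    have f2_m: "(\<lambda>q. ennreal ((norm (f i q))\<^sup>2)) \<in> borel_measurable (borel \<Otimes>\<^sub>M R)"
      using f_m[of i] by measurable
    have "(\<integral>\<^sup>+q. ennreal ((norm (f i q))\<^sup>2) \<partial>P i) = (\<integral>\<^sup>+y. ennreal ((norm (w i *\<^sub>R L (D i y)))\<^sup>2) \<partial>\<kappa> (xs i))"
      using f2_m nn_integral_distr[OF Pair_m, of "\<lambda>q. ennreal ((norm (f i q))\<^sup>2)" "xs i"]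
      by (simp add: P_def f_def)
    also have "\<dots> \<le> (\<integral>\<^sup>+y. ennreal ((w i)\<^sup>2 * (onorm L)\<^sup>2) * ennreal ((norm (D i y))\<^sup>2) \<partial>\<kappa> (xs i))"
    proof (rule nn_integral_mono)
      fix y
      have "(norm (w i *\<^sub>R L (D i y)))\<^sup>2 = (w i)\<^sup>2 * (norm (L (D i y)))\<^sup>2"
        by (simp add: power_mult_distrib)
      also have "\<dots> \<le> (w i)\<^sup>2 * (onorm L * norm (D i y))\<^sup>2"
        by (intro mult_left_mono power_mono onorm[OF L]) auto
      finally show "ennreal ((norm (w i *\<^sub>R L (D i y)))\<^sup>2)
          \<le> ennreal ((w i)\<^sup>2 * (onorm L)\<^sup>2) * ennreal ((norm (D i y))\<^sup>2)"
        by (simp add: power_mult_distrib mult.assoc flip: ennreal_mult)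
    qed
    also have "\<dots> = ennreal ((w i)\<^sup>2 * (onorm L)\<^sup>2) * (\<integral>\<^sup>+y. ennreal ((norm (D i y))\<^sup>2) \<partial>\<kappa> (xs i))"
      using D_m[of i] by (intro nn_integral_cmult) (simp add: \<kappa>_sets cong: measurable_cong_sets)
    also have "\<dots> \<le> ennreal ((w i)\<^sup>2 * (onorm L)\<^sup>2) * ennreal C"
      using moment[OF i] False by (intro mult_left_mono) (auto simp: a_def D_def)
    finally show ?thesis
      using C by (simp add: mult.assoc flip: ennreal_mult)
  qed (simp add: w0)
  have fst_eq: "AE p in PiM {1..n} P. fst (p i) = xs i" if i: "i \<in> {1..n}" for i
  proof (rule AE_PiM_component[OF P_prob i])
    show "AE q in P i. fst q = xs i"
      unfolding P_def
    proof (subst AE_distr_iff[OF Pair_m])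
      have "(\<lambda>q. fst q) -` {xs i} \<inter> space (borel \<Otimes>\<^sub>M R :: ('c \<times> 'r) measure) \<in> sets (borel \<Otimes>\<^sub>M R)"
        by (intro measurable_sets[OF measurable_fst]) auto
      then show "{q \<in> space (borel \<Otimes>\<^sub>M R). fst q = xs i} \<in> sets (borel \<Otimes>\<^sub>M R)"
        by (simp add: vimage_def Int_def conj_commute)
    qed simp
  qed
  have "AE p in PiM {1..n} P. \<forall>i\<in>{1..n}. fst (p i) = xs i"
    using fst_eq by (simp add: AE_finite_all)
  then have V_eq: "AE p in PiM {1..n} P.
      V_stat L G \<kappa> K h x (\<lambda>i p. fst (p i)) (\<lambda>i p. snd (p i)) n p = (\<Sum>i=1..n. f i (p i))"
  proof eventually_elim
    case (elim p)
    have "V_stat L G \<kappa> K h x (\<lambda>i p. fst (p i)) (\<lambda>i p. snd (p i)) n p =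
        V_stat L G \<kappa> K h x (\<lambda>i _. xs i) (\<lambda>i p. snd (p i)) n p"
      by (rule V_stat_cong) (simp_all only: elim)
    also have "\<dots> = L ((\<Sum>i=1..n. a i *\<^sub>R D i (snd (p i))) /\<^sub>R (\<Sum>i=1..n. a i))"
      unfolding V_stat_def a_def D_def ..
    \<comment> \<open>This covers zero total weight too: \<open>inverse 0 = 0\<close> makes both
      sides vanish.\<close>
    also have "\<dots> = (\<Sum>i=1..n. f i (p i))"
      by (simp add: L.scaleR L.sum f_def w_def scaleR_sum_right divide_inverse mult.commute)
    finally show ?case .
  qed
  have "(\<integral>\<^sup>+p. ennreal ((norm (V_stat L G \<kappa> K h x (\<lambda>i p. fst (p i)) (\<lambda>i p. snd (p i)) n p))\<^sup>2) \<partial>PiM {1..n} P)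
      = (\<integral>\<^sup>+p. ennreal ((norm (\<Sum>i=1..n. f i (p i)))\<^sup>2) \<partial>PiM {1..n} P)"
    using V_eq by (intro nn_integral_cong_AE) auto
  also have "\<dots> \<le> ennreal (c * (\<Sum>i=1..n. (w i)\<^sup>2 * ((onorm L)\<^sup>2 * C)))"
  proof (rule type_2_sum_PiM[OF type_2_ineq c n P_prob _ f_mean _ f_moment])
    show "f i \<in> borel_measurable (P i)" for i
      using f_m[of i] by (simp add: P_def)
  qed (use C in auto)
  also have "c * (\<Sum>i=1..n. (w i)\<^sup>2 * ((onorm L)\<^sup>2 * C)) = c * ((onorm L)\<^sup>2 * C * (\<Sum>i=1..n. (w i)\<^sup>2))"
    by (simp add: sum_distrib_left mult.commute)
  finally show ?thesis
    unfolding P_def w_def a_def .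
qed

section \<open>Averaging over the random design and passing to large n\<close>

theorem theorem3:
  fixes M :: "'w measure"
    and R :: "'r measure"
    and X :: "'w \<Rightarrow> 'c::polish_space"
    and Y :: "'w \<Rightarrow> 'r"
    and Xs :: "nat \<Rightarrow> 'w \<Rightarrow> 'c"
    and Ys :: "nat \<Rightarrow> 'w \<Rightarrow> 'r"
    and \<kappa> :: "'c \<Rightarrow> 'r measure"
    and x :: 'c
    and K :: "real \<Rightarrow> real"
    and l u \<nu> :: real
    and h :: "nat \<Rightarrow> real"
    and G :: "'r \<Rightarrow> 'g::{banach, second_countable_topology}"
    and L :: "'g \<Rightarrow> 'b::{banach, second_countable_topology}"
  assumes "prob_space M"
    and "X \<in> borel_measurable M" and "Y \<in> M \<rightarrow>\<^sub>M R"
    and "prob_space.indep_vars M (\<lambda>_. borel \<Otimes>\<^sub>M R) (\<lambda>i \<omega>. (Xs i \<omega>, Ys i \<omega>)) {1..}"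
    and "\<And>i. i \<ge> 1 \<Longrightarrow> distr M (borel \<Otimes>\<^sub>M R) (\<lambda>\<omega>. (Xs i \<omega>, Ys i \<omega>))
                          = distr M (borel \<Otimes>\<^sub>M R) (\<lambda>\<omega>. (X \<omega>, Y \<omega>))"
    and "regular_cond_distr M borel R X Y \<kappa>"
    and "type_2 TYPE('b)" and "has_schauder_basis TYPE('b)"
    and "G \<in> borel_measurable R" and "bounded_linear L"
    and "K \<in> borel_measurable (restrict_space borel {0..})" and "\<And>t. t \<ge> 0 \<Longrightarrow> K t \<ge> 0"
    and "0 < l" and "l \<le> u"
    and "\<And>t. 0 \<le> t \<Longrightarrow> t \<le> 1 \<Longrightarrow> l \<le> K t \<and> K t \<le> u"
    and "\<And>t. t > 1 \<Longrightarrow> K t = 0"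
    and "\<And>n. n \<ge> 1 \<Longrightarrow> h n > 0" and "h \<longlonglongrightarrow> 0"
    and "filterlim (\<lambda>n. real n * small_ball_prob M X x (h n)) at_top sequentially"
    and "\<nu> > 2"
    and "\<exists>C::real. \<forall>\<^sub>F z in nhds x.
           (\<integral>\<^sup>+ y. ennreal (norm (G y - cond_mean \<kappa> G z) powr \<nu>) \<partial>\<kappa> z) \<le> ennreal C"
  shows "(\<forall>\<^sub>F n in sequentially. integrable M (\<lambda>\<omega>. (norm (V_stat L G \<kappa> K h x Xs Ys n \<omega>))\<^sup>2)) \<and>
         (\<lambda>n. real n * small_ball_prob M X x (h n) *
               (\<integral>\<omega>. (norm (V_stat L G \<kappa> K h x Xs Ys n \<omega>))\<^sup>2 \<partial>M)) \<in> O(\<lambda>_. 1)"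
proof -
  \<comment> \<open>The inequality is taken on sequences of design-response pairs, the type on which
    the product law of the sample lives.\<close>
  obtain c where c: "c > 0" and type_2_ineq: "\<forall>(M :: (nat \<Rightarrow> 'c \<times> 'r) measure) (Z :: nat \<Rightarrow> (nat \<Rightarrow> 'c \<times> 'r) \<Rightarrow> 'b) n.
        n \<ge> 1 \<longrightarrow> prob_space M \<longrightarrow>
        prob_space.indep_vars M (\<lambda>_. borel) Z {1..n} \<longrightarrow>
        (\<forall>i\<in>{1..n}. integrable M (\<lambda>\<omega>. (norm (Z i \<omega>))\<^sup>2) \<and> (\<integral>\<omega>. Z i \<omega> \<partial>M) = 0) \<longrightarrow>
        (\<integral>\<omega>. (norm (\<Sum>i=1..n. Z i \<omega>))\<^sup>2 \<partial>M) \<le> c * (\<Sum>i=1..n. \<integral>\<omega>. (norm (Z i \<omega>))\<^sup>2 \<partial>M)"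
    using type_2_any_space[OF assms(7)] by blast
  interpret M: prob_space M by (rule assms(1))
  note X = assms(2) and Y = assms(3) and G = assms(9)
  have \<kappa>: "\<kappa> \<in> borel \<rightarrow>\<^sub>M prob_algebra R"
    using assms(6) by (auto simp: regular_cond_distr_def)
  have \<kappa>_prob: "prob_space (\<kappa> z)" and \<kappa>_sets: "sets (\<kappa> z) = sets R" for z
    using measurable_space[OF \<kappa>] by (auto simp: space_prob_algebra)
  obtain C0 where C0: "\<forall>\<^sub>F z in nhds x.
      (\<integral>\<^sup>+ y. ennreal (norm (G y - cond_mean \<kappa> G z) powr \<nu>) \<partial>\<kappa> z) \<le> ennreal C0"
    using assms(21) ..
  define C where "C = max 0 C0"
  have "\<forall>\<^sub>F z in nhds x.
      (\<integral>\<^sup>+ y. ennreal (norm (G y - cond_mean \<kappa> G z) powr \<nu>) \<partial>\<kappa> z) \<le> ennreal C"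
    using C0 by (rule eventually_mono) (auto simp: C_def intro: order_trans ennreal_leI)
  then obtain d where d: "d > 0" and nbhd: "\<And>z. dist z x < d \<Longrightarrow>
      (\<integral>\<^sup>+ y. ennreal (norm (G y - cond_mean \<kappa> G z) powr \<nu>) \<partial>\<kappa> z) \<le> ennreal C"
    unfolding eventually_nhds_metric by blast
  \<comment> \<open>\<open>c\<close> comes from type 2, \<open>(onorm L)\<^sup>2\<close> from
    applying \<open>L\<close>, \<open>1 + C\<close> from the conditional second moment and
    \<open>2 * u / l\<close> from the squared weights. The remaining factor, \<open>n * p n\<close>
    times the mean of \<open>1 / (1 + N)\<close>, is at most 1.\<close>
  define D where "D = c * ((onorm L)\<^sup>2 * (1 + C)) * (2 * u / l)"
  have D: "0 \<le> D"
    using c assms(13,14) by (simp add: D_def C_def)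
  define V where "V = V_stat L G \<kappa> K h x Xs Ys"
  define p where "p = (\<lambda>n. small_ball_prob M X x (h n))"
  \<comment> \<open>\<open>\<mu>\<close> is the law of a design point and \<open>k z\<close> the law
    of the whole pair given \<open>X = z\<close>.\<close>
  define \<mu> where "\<mu> = distr M borel X"
  define k where "k = (\<lambda>z. distr (\<kappa> z) (borel \<Otimes>\<^sub>M R) (Pair z))"
  interpret \<mu>: prob_space \<mu>
    unfolding \<mu>_def by (rule M.prob_space_distr[OF X])
  have k: "k \<in> borel \<rightarrow>\<^sub>M prob_algebra (borel \<Otimes>\<^sub>M R)"
    unfolding k_def by (rule measurable_distr_Pair_kernel[OF \<kappa>])
  have k\<mu>: "k \<in> \<mu> \<rightarrow>\<^sub>M prob_algebra (borel \<Otimes>\<^sub>M R)"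
    using k by (simp add: \<mu>_def)
  have joint: "distr M (borel \<Otimes>\<^sub>M R) (\<lambda>\<omega>. (X \<omega>, Y \<omega>)) = \<mu> \<bind> k"
    unfolding \<mu>_def k_def by (rule regular_cond_distr_disintegration[OF assms(1) X Y assms(6)])
  have XYs: "(\<lambda>\<omega>. (Xs i \<omega>, Ys i \<omega>)) \<in> M \<rightarrow>\<^sub>M borel \<Otimes>\<^sub>M R" if "i \<ge> 1" for i
    using assms(4) that unfolding M.indep_vars_def by auto
  have cond_mean_m: "cond_mean \<kappa> G \<in> borel_measurable borel"
    unfolding cond_mean_def
    by (rule measurable_compose[OF measurable_prob_algebraD[OF \<kappa>] integral_measurable_subprob_algebra[OF G]])

  \<comment> \<open>One constant serves every \<open>n\<close> for which the ball of radius
    \<open>h n\<close> lies in the neighbourhood of radius \<open>d\<close> where the moments are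
    bounded.\<close>
  have bound: "integrable M (\<lambda>\<omega>. (norm (V n \<omega>))\<^sup>2) \<and>
      0 \<le> real n * p n * (\<integral>\<omega>. (norm (V n \<omega>))\<^sup>2 \<partial>M) \<and>
      real n * p n * (\<integral>\<omega>. (norm (V n \<omega>))\<^sup>2 \<partial>M) \<le> D"
    if n: "n \<ge> 1" and hd: "h n < d" and np: "real n * p n > 0" for n
  proof -
    have hn: "h n > 0"
      using assms(17) n by simp
    let ?I = "{1..n}"
    let ?B = "\<Pi>\<^sub>M i\<in>?I. (borel \<Otimes>\<^sub>M R :: ('c \<times> 'r) measure)"
    \<comment> \<open>\<open>F\<close> is the statistic as a function of a tuple of pairs and
      \<open>T\<close> the sample as a random point of that product space, so only the law of
      \<open>T\<close> matters.\<close>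
    define F where "F = V_stat L G \<kappa> K h x (\<lambda>i p. fst (p i)) (\<lambda>i p. snd (p i)) n"
    define T where "T = (\<lambda>\<omega>. \<lambda>i\<in>?I. (Xs i \<omega>, Ys i \<omega>))"
    define N where "N = (\<lambda>xs :: nat \<Rightarrow> 'c. \<Sum>i\<in>?I. indicator (cball x (h n)) (xs i) :: real)"
    have VF: "V n \<omega> = F (T \<omega>)" for \<omega>
      unfolding V_def F_def T_def by (rule V_stat_cong) simp_all
    \<comment> \<open>\<open>K\<close> is assumed measurable on the half-line \<open>{0..}\<close>;
      \<open>hn\<close> keeps its argument there.\<close>
    have K_m: "(\<lambda>z. K (dist x z / h n)) \<in> borel_measurable borel"
    proof (rule measurable_compose[OF _ assms(11)])
      show "(\<lambda>z. dist x z / h n) \<in> borel \<rightarrow>\<^sub>M restrict_space borel {0..}"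
        using hn by (intro measurable_restrict_space2) auto
    qed
    have coord: "(\<lambda>p. p i) \<in> ?B \<rightarrow>\<^sub>M (borel \<Otimes>\<^sub>M R :: ('c \<times> 'r) measure)" if "i \<in> ?I" for i
      using that by (rule measurable_component_singleton)
    have fst_m: "(\<lambda>p. fst (p i)) \<in> ?B \<rightarrow>\<^sub>M borel" if "i \<in> ?I" for i
      by (rule measurable_compose[OF coord[OF that] measurable_fst])
    have snd_m: "(\<lambda>p. snd (p i)) \<in> ?B \<rightarrow>\<^sub>M R" if "i \<in> ?I" for i
      by (rule measurable_compose[OF coord[OF that] measurable_snd])
    have F_m: "F \<in> borel_measurable ?B"
      unfolding F_def V_stat_def
      by (intro measurable_compose[OF _ borel_measurable_continuous_onI[OF linear_continuous_on[OF assms(10)]]]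
          borel_measurable_scaleR borel_measurable_inverse borel_measurable_sum borel_measurable_diff
          measurable_compose[OF fst_m K_m] measurable_compose[OF snd_m G] measurable_compose[OF fst_m cond_mean_m])
    have F2_m: "(\<lambda>p. ennreal ((norm (F p))\<^sup>2)) \<in> borel_measurable ?B"
      using F_m by measurable
    have T_m: "T \<in> M \<rightarrow>\<^sub>M ?B"
      unfolding T_def by (intro measurable_restrict XYs) auto
    have V_m: "V n \<in> borel_measurable M"
      unfolding VF[abs_def] by (rule measurable_compose[OF T_m F_m])
    \<comment> \<open>Independence gives a product law; the disintegration and
      \<open>PiM_bind\<close> split it into drawing the design and then the responses.\<close>
    have "distr M ?B T = (\<Pi>\<^sub>M i\<in>?I. distr M (borel \<Otimes>\<^sub>M R) (\<lambda>\<omega>. (Xs i \<omega>, Ys i \<omega>)))"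
      unfolding T_def using n
      by (intro M.indep_vars_iff_distr_eq_PiM'[THEN iffD1] M.indep_vars_subset[OF assms(4)] XYs) auto
    also have "\<dots> = (\<Pi>\<^sub>M i\<in>?I. \<mu> \<bind> k)"
      using assms(5) by (intro PiM_cong) (auto simp: joint)
    also have "\<dots> = (\<Pi>\<^sub>M i\<in>?I. \<mu>) \<bind> (\<lambda>xs. \<Pi>\<^sub>M i\<in>?I. k (xs i))"
      by (rule PiM_bind[OF _ \<mu>.prob_space_axioms k\<mu>]) simp
    finally have law: "distr M ?B T = (\<Pi>\<^sub>M i\<in>?I. \<mu>) \<bind> (\<lambda>xs. \<Pi>\<^sub>M i\<in>?I. k (xs i))" .
    have N_nonneg: "0 \<le> N xs" for xs
      by (simp add: N_def sum_nonneg)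
    have fixed_design: "(\<integral>\<^sup>+p. ennreal ((norm (F p))\<^sup>2) \<partial>(\<Pi>\<^sub>M i\<in>?I. k (xs i))) \<le> ennreal D * ennreal (1 / (1 + N xs))"
      for xs :: "nat \<Rightarrow> 'c"
    proof -
      define a where "a = (\<lambda>i. K (dist x (xs i) / h n))"
      \<comment> \<open>The kernel vanishes beyond 1, so a nonzero weight forces the design point
        into the ball and, by \<open>h n < d\<close>, into the neighbourhood with bounded
        moments.\<close>
      have near: "dist x (xs i) \<le> h n" if "a i \<noteq> 0" for i
        using that assms(16)[of "dist x (xs i) / h n"] hn by (cases "dist x (xs i) \<le> h n") (auto simp: a_def field_simps)
      have moments: "integrable (\<kappa> (xs i)) G"
        "(\<integral>\<^sup>+y. ennreal ((norm (G y - cond_mean \<kappa> G (xs i)))\<^sup>2) \<partial>\<kappa> (xs i)) \<le> ennreal (1 + C)"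
        if "a i \<noteq> 0" for i
      proof -
        have "dist (xs i) x < d"
          using near[OF that] hd by (simp add: dist_commute)
        note le = nbhd[OF this]
        have Gi: "G \<in> borel_measurable (\<kappa> (xs i))"
          using G by (simp add: \<kappa>_sets cong: measurable_cong_sets)
        have "2 \<le> \<nu>" "0 \<le> C"
          using assms(20) by (auto simp: C_def)
        then show "integrable (\<kappa> (xs i)) G"
          "(\<integral>\<^sup>+y. ennreal ((norm (G y - cond_mean \<kappa> G (xs i)))\<^sup>2) \<partial>\<kappa> (xs i)) \<le> ennreal (1 + C)"
          using central_second_moment_le[OF \<kappa>_prob Gi _ _ le] by auto
      qed
      have "(\<integral>\<^sup>+p. ennreal ((norm (F p))\<^sup>2) \<partial>(\<Pi>\<^sub>M i\<in>?I. k (xs i)))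
          \<le> ennreal (c * ((onorm L)\<^sup>2 * (1 + C) * (\<Sum>i\<in>?I. (a i / (\<Sum>j\<in>?I. a j))\<^sup>2)))"
        unfolding F_def k_def a_def using c moments n
        by (intro nn_integral_V_stat_fixed_design_le[OF type_2_ineq _ _ \<kappa> G assms(10)])
           (auto simp: a_def C_def)
      also have "\<dots> \<le> ennreal (c * ((onorm L)\<^sup>2 * (1 + C) * (2 * u / l * (1 / (1 + N xs)))))"
      proof (intro ennreal_leI mult_left_mono)
        show "(\<Sum>i\<in>?I. (a i / (\<Sum>j\<in>?I. a j))\<^sup>2) \<le> 2 * u / l * (1 / (1 + N xs))"
          unfolding N_def
        proof (rule sum_normalized_weights_power2_le)
          show "l \<le> a i \<and> a i \<le> u" if "xs i \<in> cball x (h n)" for i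
            using assms(15)[of "dist x (xs i) / h n"] that hn by (simp add: a_def)
          show "a i = 0" if "xs i \<notin> cball x (h n)" for i
            using near[of i] that by auto
        qed (use assms(13,14) in auto)
      qed (use c in \<open>auto simp: C_def\<close>)
      also have "\<dots> = ennreal D * ennreal (1 / (1 + N xs))"
        using D N_nonneg[of xs] by (subst ennreal_mult[symmetric]) (auto simp: D_def mult.assoc)
      finally show ?thesis .
    qed
    have "(\<integral>\<^sup>+\<omega>. ennreal ((norm (V n \<omega>))\<^sup>2) \<partial>M) = (\<integral>\<^sup>+p. ennreal ((norm (F p))\<^sup>2) \<partial>distr M ?B T)"
      unfolding VF using F2_m by (intro nn_integral_distr[OF T_m, symmetric]) simp
    \<comment> \<open>Integrate over the responses with the design fixed, then over the
      design.\<close>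
    also have "\<dots> = (\<integral>\<^sup>+xs. (\<integral>\<^sup>+p. ennreal ((norm (F p))\<^sup>2) \<partial>(\<Pi>\<^sub>M i\<in>?I. k (xs i))) \<partial>(\<Pi>\<^sub>M i\<in>?I. \<mu>))"
      unfolding law
      by (rule nn_integral_bind[OF F2_m measurable_prob_algebraD[OF measurable_PiM_kernel[OF _ k\<mu>]]]) simp
    also have "\<dots> \<le> (\<integral>\<^sup>+xs. ennreal D * ennreal (1 / (1 + N xs)) \<partial>(\<Pi>\<^sub>M i\<in>?I. \<mu>))"
      by (intro nn_integral_mono fixed_design)
    also have "\<dots> = ennreal D * (\<integral>\<^sup>+xs. ennreal (1 / (1 + N xs)) \<partial>(\<Pi>\<^sub>M i\<in>?I. \<mu>))"
    proof (rule nn_integral_cmult)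
      have "N \<in> borel_measurable (\<Pi>\<^sub>M i\<in>?I. \<mu>)"
        unfolding N_def
        by (intro borel_measurable_sum measurable_compose[OF measurable_component_singleton])
           (auto simp: \<mu>_def intro!: borel_measurable_indicator)
      then show "(\<lambda>xs. ennreal (1 / (1 + N xs))) \<in> borel_measurable (\<Pi>\<^sub>M i\<in>?I. \<mu>)"
        by measurable
    qed
    finally have V_le: "(\<integral>\<^sup>+\<omega>. ennreal ((norm (V n \<omega>))\<^sup>2) \<partial>M) \<le>
        ennreal D * (\<integral>\<^sup>+xs. ennreal (1 / (1 + N xs)) \<partial>(\<Pi>\<^sub>M i\<in>?I. \<mu>))" .
    \<comment> \<open>The closed ball matches the non-strict inequality in
      \<open>small_ball_prob\<close>, so the counting lemma yields exactly the factor
      \<open>n * p n\<close>.\<close>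
    have \<mu>_ball: "emeasure \<mu> (cball x (h n)) = ennreal (p n)"
      unfolding \<mu>_def p_def small_ball_prob_def using X
      by (subst emeasure_distr) (auto simp: M.emeasure_eq_measure vimage_def Int_def conj_commute)
    have "ennreal (real n * p n) * (\<integral>\<^sup>+\<omega>. ennreal ((norm (V n \<omega>))\<^sup>2) \<partial>M) \<le>
        ennreal D * (of_nat (card ?I) * emeasure \<mu> (cball x (h n)) *
          (\<integral>\<^sup>+xs. ennreal (1 / (1 + N xs)) \<partial>(\<Pi>\<^sub>M i\<in>?I. \<mu>)))"
      using mult_left_mono[OF V_le, of "ennreal (real n * p n)"]
      by (simp add: \<mu>_ball ennreal_mult' ennreal_of_nat_eq_real_of_nat ac_simps)
    also have "\<dots> \<le> ennreal D * 1"
      unfolding N_def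
      by (intro mult_left_mono nn_integral_inverse_Suc_count_le \<mu>.prob_space_axioms) (auto simp: \<mu>_def)
    finally have npV: "ennreal (real n * p n) * (\<integral>\<^sup>+\<omega>. ennreal ((norm (V n \<omega>))\<^sup>2) \<partial>M) \<le> ennreal D"
      by simp
    \<comment> \<open>Since \<open>0 * \<infinity> = 0\<close> in the extended reals, finiteness is
      drawn from the strict positivity of \<open>n * p n\<close>.\<close>
    then have "(\<integral>\<^sup>+\<omega>. ennreal ((norm (V n \<omega>))\<^sup>2) \<partial>M) < \<infinity>"
      using np by (auto simp: ennreal_mult_top top.not_eq_extremum[symmetric] top_unique split: if_splits)
    then have int: "integrable M (\<lambda>\<omega>. (norm (V n \<omega>))\<^sup>2)"
      using V_m by (intro integrableI_nonneg) auto
    have E_nonneg: "0 \<le> (\<integral>\<omega>. (norm (V n \<omega>))\<^sup>2 \<partial>M)"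
      by (intro integral_nonneg_AE) auto
    have "ennreal (real n * p n * (\<integral>\<omega>. (norm (V n \<omega>))\<^sup>2 \<partial>M)) \<le> ennreal D"
      using npV np E_nonneg by (simp add: nn_integral_eq_integral[OF int] flip: ennreal_mult)
    then show ?thesis
      using int np D E_nonneg by (auto simp: ennreal_le_iff)
  qed
  have ev: "\<forall>\<^sub>F n in sequentially. n \<ge> 1 \<and> h n < d \<and> real n * p n > 0"
    using eventually_ge_at_top[of 1] order_tendstoD(2)[OF assms(18) d]
      assms(19)[unfolded filterlim_at_top_dense, rule_format, of 0]
    unfolding p_def by eventually_elim auto
  have "\<forall>\<^sub>F n in sequentially. integrable M (\<lambda>\<omega>. (norm (V n \<omega>))\<^sup>2)"
    using ev by eventually_elim (use bound in blast)
  moreover have "(\<lambda>n. real n * p n * (\<integral>\<omega>. (norm (V n \<omega>))\<^sup>2 \<partial>M)) \<in> O(\<lambda>_. 1)"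
  proof (rule bigoI)
    show "\<forall>\<^sub>F n in sequentially. norm (real n * p n * (\<integral>\<omega>. (norm (V n \<omega>))\<^sup>2 \<partial>M)) \<le> D * norm (1 :: real)"
      using ev by eventually_elim (use bound in force)
  qed
  ultimately show ?thesis
    unfolding V_def p_def by blast
qed

end
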